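(* Consider the bilevel polynomial optimization problem (B) and Algorithm A, both described in the context, under the standing assumptions, the Lagrange multiplier assumption and the polynomial extension assumption stated there. Assume the following: (a) All optimization problems $(P_k)$ and $(Q_k)$ occurring in Algorithm A have global minimizers. (b) Algorithm A does not terminate at any loop, so it produces an infinite sequence $\{(x^{(k)},y^{(k)},z^{(k)})\}_{k=0}^\infty$, together with the polynomial extensions $q^{(k)}$. (c) $(x^*,y^*,z^* )$ is an accumulation point of $\{(x^{(k)},y^{(k)},z^{(k)})\}_{k=0}^\infty$, and the value function $v(x)=\inf_{z\in Z(x)}f(x,z)$ is continuous at $x^*$. (d) The polynomial functions $q^{(k)}(x,y)$ converge to $q^{(k)}(x^*,y^* )$ uniformly for $k\in\mathbb{N}$ as $(x,y)\to(x^*,y^* )$; that is, for every $\varepsilon>0$ there is $\delta>0$ such that $\|q^{(k)}(x,y)-q^{(k)}(x^*,y^* )\|<\varepsilon$ for all $k\in\mathbb{N}$ and all $(x,y)$ with $\|(x,y)-(x^*,y^* )\|<\delta$. Then $(x^*,y^* )$ is a global minimizer of the bilevel optimization problem (B).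
   Context: **Problem.** Let $\mathcal{E}_1,\mathcal{I}_1$ be disjoint finite index sets and let $\mathcal{E}_2,\mathcal{I}_2$ be disjoint finite index sets with $\mathcal{E}_2\cup\mathcal{I}_2=\{1,\dots,m_2\}$ (any of them may be empty). Let $F(x,y)$, $h_i(x,y)$ ($i\in\mathcal{E}_1\cup\mathcal{I}_1$), $f(x,z)$, $g_j(x,z)$ ($j\in\mathcal{E}_2\cup\mathcal{I}_2$) be real polynomials, with $x\in\mathbb{R}^n$ and $y,z\in\mathbb{R}^p$. Set $$Z(x)=\{z\in\mathbb{R}^p: g_i(x,z)=0\ (i\in\mathcal{E}_2),\ g_j(x,z)\ge0\ (j\in\mathcal{I}_2)\}.$$ For given $x$, the lower level problem $(P_x)$ is to minimize $f(x,z)$ over $z\in Z(x)$; $S(x)$ is its set of global minimizers, and $v(x)=\inf_{z\in Z(x)}f(x,z)$. The bilevel problem (B) is $$F^*=\min_{x\in\mathbb{R}^n,\,y\in\mathbb{R}^p}F(x,y)\quad\text{s.t. } h_i(x,y)=0\ (i\in\mathcal{E}_1),\ h_j(x,y)\ge0\ (j\in\mathcal{I}_1),\ y\in S(x).$$ Let $$\mathcal{U}=\{(x,y): h_i(x,y)=0\ (i\in\mathcal{E}_1),\ h_j(x,y)\ge0\ (j\in\mathcal{I}_1),\ y\in Z(x)\}.$$ Call $x$ feasible if $(x,y)\in\mathcal{U}$ for some $y$. **KKT points.** A pair $(x,y)$ with $y\in Z(x)$ is a KKT point (of the lower level problem) if there is $\lambda\in\mathbb{R}^{m_2}$ with $\nabla_z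 f(x,y)=\sum_{j=1}^{m_2}\lambda_j\nabla_z g_j(x,y)$, $\lambda_jg_j(x,y)=0$ for all $j$, and $\lambda_j\ge0$ for $j\in\mathcal{I}_2$. Here $\nabla_z$ is the gradient in the second argument, evaluated at $z=y$. **Standing assumptions.** For every feasible $x$: $S(x)\neq\emptyset$, and for every $y\in S(x)$ the pair $(x,y)$ is a KKT point. **Lagrange multiplier assumption.** There are nonzero polynomials $d_1(x,y),\dots,d_{m_2}(x,y)$, nonnegative on $\mathcal{U}$, and not identically zero polynomials $\phi_1(x,y),\dots,\phi_{m_2}(x,y)$ such that $\lambda_jd_j(x,y)=\phi_j(x,y)$, $j=1,\dots,m_2$, for all KKT points $(x,y)$ and associated multipliers $\lambda$. Let $D$ be the least common multiple of $d_1,\dots,d_{m_2}$, let $D_j=D/d_j$, and let $\mathcal{K}$ be the set of $(x,y)$ satisfying $$D\nabla_zf(x,y)-\sum_{j=1}^{m_2}D_j\phi_j\nabla_zg_j(x,y)=0,\qquad \phi_j(x,y)\ge0,\ \phi_j(x,y)g_j(x,y)=0\ (j\in\mathcal{I}_2)$$ ($D,D_j,\phi_j$ evaluated at $(x,y)$). **Polynomial extension assumption.** For every $(\hat x,\hat y)\in\mathcal{U}\cap\mathcal{K}$ and every $\hat z\in S(\hat x)$ there is a tuple of polynomials $q(x,y)=(q_1(x,y),\dots,q_p(x,y))$ with $q(\hat x,\hat y)=\hat z$ and $q(x,y)\in Z(x)$ for all $(x,y)\in\mathcal{U}$. Such a $q$ is called a polynomial extension of $\hat z$ at $(\hat x,\hat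 y)$. **Algorithm A.** All subproblems are solved exactly (globally). - Step 0: Let $\mathcal{U}_0=\mathcal{U}\cap\mathcal{K}$ and $k=0$. - Step 1: Solve $(P_k)$: $F_k^*=\min F(x,y)$ s.t. $(x,y)\in\mathcal{U}_k$. If infeasible, stop without output. Otherwise let $(x^{(k)},y^{(k)})$ be a global minimizer. - Step 2: Solve $(Q_k)$: $\upsilon_k^*=\min_z f(x^{(k)},z)-f(x^{(k)},y^{(k)})$ s.t. $z\in Z(x^{(k)})$, $(x^{(k)},z)\in\mathcal{K}$, and let $z^{(k)}$ be a global minimizer. If $\upsilon_k^*=0$, stop and output $(x^{(k)},y^{(k)})$. - Step 3: Otherwise choose a polynomial extension $q^{(k)}$ of $z^{(k)}$ at $(x^{(k)},y^{(k)})$, i.e. a polynomial tuple with $q^{(k)}(x^{(k)},y^{(k)})=z^{(k)}$ and $q^{(k)}(x,y)\in Z(x)$ for all $(x,y)\in\mathcal{U}$. Set $\mathcal{U}_{k+1}=\{(x,y)\in\mathcal{U}_k: f(x,q^{(k)}(x,y))-f(x,y)\ge0\}$, replace $k$ by $k+1$, and go to Step 1.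
   Formalization: In Step 3 a polynomial extension of z^(k) is additionally required to have z^(k) in S(x^(k)); without this the claim can fail, since d_j is only assumed nonnegative on U and the minimizer of (Q_k) need not solve the lower level problem. *)

theory Defs
  imports "HOL-Analysis.Analysis"
begin

text \<open>Real polynomials in \<open>(x, y)\<close> are represented by the polynomial functions they induce
  (\<^const>\<open>real_polynomial_function\<close>, \<^const>\<open>polynomial_function\<close>); over the infinite field of real
  numbers the two are in bijection, compatibly with the ring operations and divisibility.\<close>

record ('i, 'n::finite, 'p::finite) bilevel =
  upper_obj :: "(real^'n) \<times> (real^'p) \<Rightarrow> real"
  upper_con :: "'i \<Rightarrow> (real^'n) \<times> (real^'p) \<Rightarrow> real"
  upper_eq :: "'i set"
  upper_ineq :: "'i set"
  lower_obj :: "(real^'n) \<times> (real^'p) \<Rightarrow> real"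
  lower_con :: "nat \<Rightarrow> (real^'n) \<times> (real^'p) \<Rightarrow> real"
  lower_eq :: "nat set"
  lower_ineq :: "nat set"
  num_lower :: nat

definition bilevel_polynomial_problem :: "('i, 'n::finite, 'p::finite) bilevel \<Rightarrow> bool" where
  "bilevel_polynomial_problem P \<longleftrightarrow>
     finite (upper_eq P) \<and> finite (upper_ineq P) \<and> upper_eq P \<inter> upper_ineq P = {} \<and>
     lower_eq P \<inter> lower_ineq P = {} \<and> lower_eq P \<union> lower_ineq P = {1..num_lower P} \<and>
     real_polynomial_function (upper_obj P) \<and>
     (\<forall>i \<in> upper_eq P \<union> upper_ineq P. real_polynomial_function (upper_con P i)) \<and>
     real_polynomial_function (lower_obj P) \<and>
     (\<forall>j \<in> lower_eq P \<union> lower_ineq P. real_polynomial_function (lower_con P j))"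

definition lower_feasible :: "('i, 'n::finite, 'p::finite) bilevel \<Rightarrow> real^'n \<Rightarrow> (real^'p) set" where
  "lower_feasible P x =
     {z. (\<forall>i \<in> lower_eq P. lower_con P i (x, z) = 0) \<and> (\<forall>j \<in> lower_ineq P. lower_con P j (x, z) \<ge> 0)}"

definition lower_solutions :: "('i, 'n::finite, 'p::finite) bilevel \<Rightarrow> real^'n \<Rightarrow> (real^'p) set" where
  "lower_solutions P x =
     {z. is_arg_min (\<lambda>z. lower_obj P (x, z)) (\<lambda>z. z \<in> lower_feasible P x) z}"

text \<open>Extended-real valued, so that the infimum is \<open>\<infinity>\<close> where the lower level problem is infeasible
  and \<open>-\<infinity>\<close> where it is unbounded.\<close>

definition value_function :: "('i, 'n::finite, 'p::finite) bilevel \<Rightarrow> real^'n \<Rightarrow> ereal" where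
  "value_function P x = (INF z \<in> lower_feasible P x. ereal (lower_obj P (x, z)))"

definition relaxed_feasible :: "('i, 'n::finite, 'p::finite) bilevel \<Rightarrow> ((real^'n) \<times> (real^'p)) set" where
  "relaxed_feasible P =
     {(x, y). (\<forall>i \<in> upper_eq P. upper_con P i (x, y) = 0) \<and>
              (\<forall>j \<in> upper_ineq P. upper_con P j (x, y) \<ge> 0) \<and> y \<in> lower_feasible P x}"

definition bilevel_feasible :: "('i, 'n::finite, 'p::finite) bilevel \<Rightarrow> ((real^'n) \<times> (real^'p)) set" where
  "bilevel_feasible P =
     {(x, y). (\<forall>i \<in> upper_eq P. upper_con P i (x, y) = 0) \<and>
              (\<forall>j \<in> upper_ineq P. upper_con P j (x, y) \<ge> 0) \<and> y \<in> lower_solutions P x}"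

definition grad_snd :: "((real^'n::finite) \<times> (real^'p::finite) \<Rightarrow> real) \<Rightarrow> real^'n \<Rightarrow> real^'p \<Rightarrow> real^'p" where
  "grad_snd u x y = (THE v. GDERIV (\<lambda>z. u (x, z)) y :> v)"

definition lagrange_multiplier ::
  "('i, 'n::finite, 'p::finite) bilevel \<Rightarrow> real^'n \<Rightarrow> real^'p \<Rightarrow> (nat \<Rightarrow> real) \<Rightarrow> bool" where
  "lagrange_multiplier P x y l \<longleftrightarrow>
     grad_snd (lower_obj P) x y = (\<Sum>j = 1..num_lower P. l j *\<^sub>R grad_snd (lower_con P j) x y) \<and>
     (\<forall>j \<in> {1..num_lower P}. l j * lower_con P j (x, y) = 0) \<and>
     (\<forall>j \<in> lower_ineq P. l j \<ge> 0)"

definition KKT_point :: "('i, 'n::finite, 'p::finite) bilevel \<Rightarrow> real^'n \<Rightarrow> real^'p \<Rightarrow> bool" where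
  "KKT_point P x y \<longleftrightarrow> y \<in> lower_feasible P x \<and> (\<exists>l. lagrange_multiplier P x y l)"

definition standing_assumptions :: "('i, 'n::finite, 'p::finite) bilevel \<Rightarrow> bool" where
  "standing_assumptions P \<longleftrightarrow>
     (\<forall>x. (\<exists>y. (x, y) \<in> relaxed_feasible P) \<longrightarrow>
        lower_solutions P x \<noteq> {} \<and> (\<forall>y \<in> lower_solutions P x. KKT_point P x y))"

definition poly_dvd :: "('a::real_normed_vector \<Rightarrow> real) \<Rightarrow> ('a \<Rightarrow> real) \<Rightarrow> bool" where
  "poly_dvd u v \<longleftrightarrow> (\<exists>s. real_polynomial_function s \<and> (\<forall>w. v w = u w * s w))"

text \<open>A least common multiple is determined up to a nonzero constant factor.  Such a factor scales
  the gradient equation in \<open>KKT_set\<close> and nothing else there, so it does not affect that set.\<close>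

definition is_poly_lcm ::
  "nat set \<Rightarrow> (nat \<Rightarrow> 'a::real_normed_vector \<Rightarrow> real) \<Rightarrow> ('a \<Rightarrow> real) \<Rightarrow> bool" where
  "is_poly_lcm J d D \<longleftrightarrow>
     real_polynomial_function D \<and> (\<forall>j \<in> J. poly_dvd (d j) D) \<and>
     (\<forall>E. real_polynomial_function E \<and> (\<forall>j \<in> J. poly_dvd (d j) E) \<longrightarrow> poly_dvd D E)"

text \<open>\<open>Dj j\<close> is the polynomial quotient \<open>D / d j\<close>, characterised by multiplication because pointwise
  division would be \<open>0\<close> on the zero set of \<open>d j\<close>.\<close>

definition lagrange_multiplier_assumption ::
  "('i, 'n::finite, 'p::finite) bilevel \<Rightarrow>
   (nat \<Rightarrow> (real^'n) \<times> (real^'p) \<Rightarrow> real) \<Rightarrow> (nat \<Rightarrow> (real^'n) \<times> (real^'p) \<Rightarrow> real) \<Rightarrow>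
   ((real^'n) \<times> (real^'p) \<Rightarrow> real) \<Rightarrow> (nat \<Rightarrow> (real^'n) \<times> (real^'p) \<Rightarrow> real) \<Rightarrow> bool" where
  "lagrange_multiplier_assumption P d \<phi> D Dj \<longleftrightarrow>
     (\<forall>j \<in> {1..num_lower P}.
        real_polynomial_function (d j) \<and> (\<exists>w. d j w \<noteq> 0) \<and> (\<forall>w \<in> relaxed_feasible P. d j w \<ge> 0) \<and>
        real_polynomial_function (\<phi> j) \<and> (\<exists>w. \<phi> j w \<noteq> 0)) \<and>
     (\<forall>x y l. KKT_point P x y \<and> lagrange_multiplier P x y l \<longrightarrow>
        (\<forall>j \<in> {1..num_lower P}. l j * d j (x, y) = \<phi> j (x, y))) \<and>
     is_poly_lcm {1..num_lower P} d D \<and>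
     (\<forall>j \<in> {1..num_lower P}. real_polynomial_function (Dj j) \<and> (\<forall>w. D w = d j w * Dj j w))"

definition KKT_set ::
  "('i, 'n::finite, 'p::finite) bilevel \<Rightarrow> (nat \<Rightarrow> (real^'n) \<times> (real^'p) \<Rightarrow> real) \<Rightarrow>
   ((real^'n) \<times> (real^'p) \<Rightarrow> real) \<Rightarrow> (nat \<Rightarrow> (real^'n) \<times> (real^'p) \<Rightarrow> real) \<Rightarrow>
   ((real^'n) \<times> (real^'p)) set" where
  "KKT_set P \<phi> D Dj =
     {(x, y).
        D (x, y) *\<^sub>R grad_snd (lower_obj P) x y
          - (\<Sum>j = 1..num_lower P. (Dj j (x, y) * \<phi> j (x, y)) *\<^sub>R grad_snd (lower_con P j) x y) = 0 \<and>
        (\<forall>j \<in> lower_ineq P. \<phi> j (x, y) \<ge> 0 \<and> \<phi> j (x, y) * lower_con P j (x, y) = 0)}"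

text \<open>Below, \<open>K\<close> stands for the set \<open>KKT_set P \<phi> D Dj\<close>.

  Polynomial extensions are extensions of lower level minimizers, so the condition
  \<open>z \<in> lower_solutions P x\<close> belongs to the notion.  It is not automatic for a point computed by the
  algorithm: a minimizer of the lower level problem restricted to \<open>K\<close> need not be a minimizer of the
  lower level problem, since the polynomials \<open>d j\<close> may be negative at pairs \<open>(x, z)\<close> with
  \<open>z \<in> lower_solutions P x\<close> that violate the upper level constraints.\<close>

definition polynomial_extension ::
  "('i, 'n::finite, 'p::finite) bilevel \<Rightarrow> ((real^'n) \<times> (real^'p)) set \<Rightarrow> real^'n \<Rightarrow> real^'p \<Rightarrow> real^'p \<Rightarrow>
   ((real^'n) \<times> (real^'p) \<Rightarrow> real^'p) \<Rightarrow> bool" where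
  "polynomial_extension P K x y z q \<longleftrightarrow>
     (x, y) \<in> relaxed_feasible P \<inter> K \<and> z \<in> lower_solutions P x \<and>
     polynomial_function q \<and> q (x, y) = z \<and>
     (\<forall>(x', y') \<in> relaxed_feasible P. q (x', y') \<in> lower_feasible P x')"

definition polynomial_extension_assumption ::
  "('i, 'n::finite, 'p::finite) bilevel \<Rightarrow> ((real^'n) \<times> (real^'p)) set \<Rightarrow> bool" where
  "polynomial_extension_assumption P K \<longleftrightarrow>
     (\<forall>(x, y) \<in> relaxed_feasible P \<inter> K. \<forall>z \<in> lower_solutions P x. \<exists>q. polynomial_extension P K x y z q)"

primrec alg_feasible ::
  "('i, 'n::finite, 'p::finite) bilevel \<Rightarrow> ((real^'n) \<times> (real^'p)) set \<Rightarrow>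
   (nat \<Rightarrow> (real^'n) \<times> (real^'p) \<Rightarrow> real^'p) \<Rightarrow> nat \<Rightarrow> ((real^'n) \<times> (real^'p)) set" where
  "alg_feasible P K q 0 = relaxed_feasible P \<inter> K"
| "alg_feasible P K q (Suc k) =
     {(x, y) \<in> alg_feasible P K q k. lower_obj P (x, q k (x, y)) - lower_obj P (x, y) \<ge> 0}"

definition solves_P ::
  "('i, 'n::finite, 'p::finite) bilevel \<Rightarrow> ((real^'n) \<times> (real^'p)) set \<Rightarrow>
   (nat \<Rightarrow> (real^'n) \<times> (real^'p) \<Rightarrow> real^'p) \<Rightarrow> nat \<Rightarrow> (real^'n) \<times> (real^'p) \<Rightarrow> bool" where
  "solves_P P K q k w \<longleftrightarrow> is_arg_min (upper_obj P) (\<lambda>w. w \<in> alg_feasible P K q k) w"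

definition solves_Q ::
  "('i, 'n::finite, 'p::finite) bilevel \<Rightarrow> ((real^'n) \<times> (real^'p)) set \<Rightarrow>
   real^'n \<Rightarrow> real^'p \<Rightarrow> real^'p \<Rightarrow> bool" where
  "solves_Q P K x y z \<longleftrightarrow>
     is_arg_min (\<lambda>z. lower_obj P (x, z) - lower_obj P (x, y))
       (\<lambda>z. z \<in> lower_feasible P x \<and> (x, z) \<in> K) z"

text \<open>The optimal value of the second subproblem is its objective value at the minimizer \<open>z k\<close>; the
  algorithm continues because this value is nonzero in every loop.\<close>

definition infinite_run ::
  "('i, 'n::finite, 'p::finite) bilevel \<Rightarrow> ((real^'n) \<times> (real^'p)) set \<Rightarrow>
   (nat \<Rightarrow> real^'n) \<Rightarrow> (nat \<Rightarrow> real^'p) \<Rightarrow> (nat \<Rightarrow> real^'p) \<Rightarrow>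
   (nat \<Rightarrow> (real^'n) \<times> (real^'p) \<Rightarrow> real^'p) \<Rightarrow> bool" where
  "infinite_run P K x y z q \<longleftrightarrow>
     (\<forall>k. solves_P P K q k (x k, y k) \<and>
          solves_Q P K (x k) (y k) (z k) \<and>
          lower_obj P (x k, z k) - lower_obj P (x k, y k) \<noteq> 0 \<and>
          polynomial_extension P K (x k) (y k) (z k) (q k))"

definition bilevel_minimizer ::
  "('i, 'n::finite, 'p::finite) bilevel \<Rightarrow> (real^'n) \<times> (real^'p) \<Rightarrow> bool" where
  "bilevel_minimizer P w \<longleftrightarrow> is_arg_min (upper_obj P) (\<lambda>w. w \<in> bilevel_feasible P) w"

end

theory Submission
  imports Defs
begin

text \<open>Let \<open>U\<close> be the relaxed feasible set, \<open>Z x\<close> the lower level feasible set, \<open>f\<close> and \<open>F\<close> the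
  lower and upper level objectives, \<open>v\<close> the value function and \<open>(xs, ys, zs)\<close> the accumulation
  point.  The proof has two halves.

  \<^emph>\<open>Optimality.\<close>  No bilevel feasible point is ever cut off by the algorithm: it satisfies the
  KKT conditions defining \<open>K\<close> (\<open>bilevel_feasible_subset_KKT_set\<close>), and each cut compares the objective
  value at \<open>y\<close> with that at a point of \<open>Z x\<close>, which cannot beat a lower level minimizer
  (\<open>bilevel_feasible_subset_alg_feasible\<close>).  So every iterate minimizes \<open>F\<close> over a superset of the
  bilevel feasible set, and the lower bound \<open>F (x k, y k)\<close> passes to the limit.

  \<^emph>\<open>Feasibility.\<close>  Since \<open>U\<close> is closed, \<open>(xs, ys)\<close> lies in \<open>U\<close>, and what remains is
  \<open>f (xs, ys) \<le> v xs\<close>.  The cut made in loop \<open>k\<close> holds at all later iterates, hence at the limit: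
  \<open>f (xs, ys) \<le> f (xs, q k (xs, ys))\<close> for every \<open>k\<close>.  Equicontinuity of the \<open>q k\<close> at \<open>(xs, ys)\<close>
  makes \<open>q k (xs, ys)\<close> and \<open>z k = q k (x k, y k)\<close> close along the subsequence, so
  the former also tend to \<open>zs\<close>, and \<open>f (xs, ys) \<le> f (xs, zs)\<close>.  Finally \<open>f (x k, z k) = v (x k)\<close>,
  because polynomial extensions are taken of lower level minimizers, so continuity of \<open>v\<close> gives
  \<open>f (xs, zs) = v xs\<close>.\<close>

lemma continuous_on_real_polynomial_function:
  assumes "real_polynomial_function f"
  shows "continuous_on S f"
  using assms by (simp add: continuous_on_polymonial_function real_polynomial_function_eq)

lemma lower_solutions_iff:
  "z \<in> lower_solutions P x \<longleftrightarrow>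
     z \<in> lower_feasible P x \<and> (\<forall>z' \<in> lower_feasible P x. lower_obj P (x, z) \<le> lower_obj P (x, z'))"
  by (auto simp: lower_solutions_def is_arg_min_linorder)

lemma bilevel_feasible_iff:
  "(x, y) \<in> bilevel_feasible P \<longleftrightarrow> (x, y) \<in> relaxed_feasible P \<and> y \<in> lower_solutions P x"
  by (auto simp: bilevel_feasible_def relaxed_feasible_def lower_solutions_iff)

lemma value_function_eq_lower_obj:
  assumes "z \<in> lower_solutions P x"
  shows "value_function P x = ereal (lower_obj P (x, z))"
  unfolding value_function_def
  using assms by (intro antisym INF_greatest) (auto simp: lower_solutions_iff intro: INF_lower)

lemma closed_relaxed_feasible:
  fixes P :: "('i, 'n::finite, 'p::finite) bilevel"
  assumes "bilevel_polynomial_problem P"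
  shows "closed (relaxed_feasible P)"
proof -
  have eq: "relaxed_feasible P =
      (\<Inter>i \<in> upper_eq P. {w. upper_con P i w = 0}) \<inter> (\<Inter>i \<in> upper_ineq P. {w. 0 \<le> upper_con P i w}) \<inter>
      (\<Inter>j \<in> lower_eq P. {w. lower_con P j w = 0}) \<inter> (\<Inter>j \<in> lower_ineq P. {w. 0 \<le> lower_con P j w})"
    by (auto simp: relaxed_feasible_def lower_feasible_def)
  show ?thesis
    unfolding eq using assms
    by (intro closed_Int closed_INT ballI closed_Collect_eq closed_Collect_le continuous_on_const
          continuous_on_real_polynomial_function)
       (auto simp: bilevel_polynomial_problem_def)
qed

text \<open>A lower level minimizer has a multiplier \<open>l\<close>, and on KKT points \<open>l j * d j = \<phi> j\<close> and
  \<open>D = d j * Dj j\<close>, so \<open>Dj j * \<phi> j = D * l j\<close>: the gradient equation of \<open>K\<close> is that of \<open>l\<close>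
  multiplied by \<open>D\<close>.  The upper level constraints enter through the sign of \<open>d j\<close>, which turns
  \<open>l j \<ge> 0\<close> into \<open>\<phi> j \<ge> 0\<close>.\<close>

lemma bilevel_feasible_subset_KKT_set:
  fixes P :: "('i, 'n::finite, 'p::finite) bilevel"
  assumes prob: "bilevel_polynomial_problem P"
    and stand: "standing_assumptions P"
    and lag: "lagrange_multiplier_assumption P d \<phi> D Dj"
  shows "bilevel_feasible P \<subseteq> KKT_set P \<phi> D Dj"
proof clarify
  fix x y
  assume "(x, y) \<in> bilevel_feasible P"
  then have U: "(x, y) \<in> relaxed_feasible P" and S: "y \<in> lower_solutions P x"
    by (auto simp: bilevel_feasible_iff)
  have kkt: "KKT_point P x y"
    using stand U S unfolding standing_assumptions_def by blast
  then obtain l where l: "lagrange_multiplier P x y l"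
    unfolding KKT_point_def by blast
  have phi: "\<phi> j (x, y) = l j * d j (x, y)" if "j \<in> {1..num_lower P}" for j
    using lag kkt l that unfolding lagrange_multiplier_assumption_def by metis
  have D: "D (x, y) = d j (x, y) * Dj j (x, y)" and d: "0 \<le> d j (x, y)"
    if "j \<in> {1..num_lower P}" for j
    using lag U that unfolding lagrange_multiplier_assumption_def by blast+
  have "D (x, y) *\<^sub>R grad_snd (lower_obj P) x y =
      (\<Sum>j = 1..num_lower P. (D (x, y) * l j) *\<^sub>R grad_snd (lower_con P j) x y)"
    using l unfolding lagrange_multiplier_def by (simp add: scaleR_sum_right)
  also have "\<dots> = (\<Sum>j = 1..num_lower P. (Dj j (x, y) * \<phi> j (x, y)) *\<^sub>R grad_snd (lower_con P j) x y)"
    by (intro sum.cong) (simp_all add: phi D mult_ac)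
  finally have grad: "D (x, y) *\<^sub>R grad_snd (lower_obj P) x y =
      (\<Sum>j = 1..num_lower P. (Dj j (x, y) * \<phi> j (x, y)) *\<^sub>R grad_snd (lower_con P j) x y)" .
  have ineq: "0 \<le> \<phi> j (x, y) \<and> \<phi> j (x, y) * lower_con P j (x, y) = 0" if j: "j \<in> lower_ineq P" for j
  proof -
    have j': "j \<in> {1..num_lower P}"
      using prob j unfolding bilevel_polynomial_problem_def by blast
    have "0 \<le> l j" "l j * lower_con P j (x, y) = 0"
      using l j j' unfolding lagrange_multiplier_def by blast+
    then show ?thesis
      using phi[OF j'] d[OF j'] by auto
  qed
  show "(x, y) \<in> KKT_set P \<phi> D Dj"
    using grad ineq by (simp add: KKT_set_def)
qed

lemma bilevel_feasible_subset_alg_feasible: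
  assumes K: "bilevel_feasible P \<subseteq> K"
    and q: "\<And>k x y. (x, y) \<in> relaxed_feasible P \<Longrightarrow> q k (x, y) \<in> lower_feasible P x"
  shows "bilevel_feasible P \<subseteq> alg_feasible P K q k"
proof (induction k)
  case 0
  show ?case
    using K by (auto simp: bilevel_feasible_iff)
next
  case (Suc k)
  then show ?case
    using q by (auto simp: bilevel_feasible_iff lower_solutions_iff)
qed

lemma antimono_alg_feasible: "antimono (alg_feasible P K q)"
  by (rule antimonoI, rule lift_Suc_antimono_le) auto

text \<open>Equicontinuity transfers convergence from a moving argument to the limit argument even though
  the functions move as well.\<close>

lemma tendsto_at_limit_point_if_equicontinuous:
  fixes q :: "nat \<Rightarrow> 'a::real_normed_vector \<Rightarrow> 'b::real_normed_vector"
  assumes equicont: "\<forall>\<epsilon>>0. \<exists>\<delta>>0. \<forall>k w. norm (w - a) < \<delta> \<longrightarrow> norm (q k w - q k a) < \<epsilon>"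
    and w: "w \<longlonglongrightarrow> a"
    and lim: "(\<lambda>n. q (r n) (w n)) \<longlonglongrightarrow> b"
  shows "(\<lambda>n. q (r n) a) \<longlonglongrightarrow> b"
proof -
  have "(\<lambda>n. q (r n) (w n) - q (r n) a) \<longlonglongrightarrow> 0"
  proof (rule tendstoI)
    fix e :: real
    assume "0 < e"
    then obtain \<delta> where "0 < \<delta>" and \<delta>: "\<And>k w. norm (w - a) < \<delta> \<Longrightarrow> norm (q k w - q k a) < e"
      using equicont by blast
    have "\<forall>\<^sub>F n in sequentially. dist (w n) a < \<delta>"
      using w \<open>0 < \<delta>\<close> by (rule tendstoD)
    then show "\<forall>\<^sub>F n in sequentially. dist (q (r n) (w n) - q (r n) a) 0 < e"
      by eventually_elim (simp add: \<delta> dist_norm)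
  qed
  from tendsto_diff[OF lim this] show ?thesis
    by simp
qed

text \<open>Iterates beyond the \<open>k\<close>-th satisfy the \<open>k\<close>-th cut, and the cut is a closed condition.\<close>

lemma cut_holds_at_accumulation_point:
  assumes f: "continuous_on UNIV (lower_obj P)"
    and q: "continuous_on UNIV (q k)"
    and iter: "\<And>n. (x n, y n) \<in> alg_feasible P K q n"
    and r: "strict_mono r"
    and x: "(\<lambda>n. x (r n)) \<longlonglongrightarrow> xs" and y: "(\<lambda>n. y (r n)) \<longlonglongrightarrow> ys"
  shows "lower_obj P (xs, ys) \<le> lower_obj P (xs, q k (xs, ys))"
proof (rule tendsto_le)
  show "(\<lambda>n. lower_obj P (x (r n), y (r n))) \<longlonglongrightarrow> lower_obj P (xs, ys)"
    by (intro continuous_on_tendsto_compose[OF f] tendsto_Pair x y) auto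
  show "(\<lambda>n. lower_obj P (x (r n), q k (x (r n), y (r n)))) \<longlonglongrightarrow> lower_obj P (xs, q k (xs, ys))"
    by (intro continuous_on_tendsto_compose[OF f] continuous_on_tendsto_compose[OF q]
          tendsto_Pair x y) auto
  show "\<forall>\<^sub>F n in sequentially.
      lower_obj P (x (r n), y (r n)) \<le> lower_obj P (x (r n), q k (x (r n), y (r n)))"
  proof (rule eventually_sequentiallyI)
    fix n
    assume "Suc k \<le> n"
    then have "Suc k \<le> r n"
      using seq_suble[OF r, of n] by linarith
    then have "(x (r n), y (r n)) \<in> alg_feasible P K q (Suc k)"
      using iter[of "r n"] antimonoD[OF antimono_alg_feasible] by blast
    then show "lower_obj P (x (r n), y (r n)) \<le> lower_obj P (x (r n), q k (x (r n), y (r n)))"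
      by simp
  qed
qed simp

theorem theorem3p6:
  fixes P :: "('i, 'n::finite, 'p::finite) bilevel"
    and d \<phi> Dj :: "nat \<Rightarrow> (real^'n) \<times> (real^'p) \<Rightarrow> real"
    and D :: "(real^'n) \<times> (real^'p) \<Rightarrow> real"
    and K :: "((real^'n) \<times> (real^'p)) set"
    and x :: "nat \<Rightarrow> real^'n" and y z :: "nat \<Rightarrow> real^'p"
    and q :: "nat \<Rightarrow> (real^'n) \<times> (real^'p) \<Rightarrow> real^'p"
    and xs :: "real^'n" and ys zs :: "real^'p"
  assumes "bilevel_polynomial_problem P"
    and "standing_assumptions P"
    and "lagrange_multiplier_assumption P d \<phi> D Dj"
    and "K = KKT_set P \<phi> D Dj"
    and "polynomial_extension_assumption P K"
    and a: "\<forall>k. (\<exists>w. solves_P P K q k w) \<and> (\<exists>z'. solves_Q P K (x k) (y k) z')"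
    and b: "infinite_run P K x y z q"
    and c: "\<exists>r. strict_mono r \<and> (\<lambda>k. (x (r k), y (r k), z (r k))) \<longlonglongrightarrow> (xs, ys, zs)"
           "isCont (value_function P) xs"
    and d: "\<forall>\<epsilon>>0. \<exists>\<delta>>0. \<forall>k w. norm (w - (xs, ys)) < \<delta> \<longrightarrow> norm (q k w - q k (xs, ys)) < \<epsilon>"
  shows "bilevel_minimizer P (xs, ys)"
proof -
  obtain r where r: "strict_mono r"
    and lim: "(\<lambda>k. (x (r k), y (r k), z (r k))) \<longlonglongrightarrow> (xs, ys, zs)"
    using c(1) by blast
  have x: "(\<lambda>n. x (r n)) \<longlonglongrightarrow> xs" and y: "(\<lambda>n. y (r n)) \<longlonglongrightarrow> ys" and z: "(\<lambda>n. z (r n)) \<longlonglongrightarrow> zs"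
    using tendsto_fst[OF lim] tendsto_fst[OF tendsto_snd[OF lim]] tendsto_snd[OF tendsto_snd[OF lim]]
    by simp_all
  have f: "continuous_on UNIV (lower_obj P)" and F: "continuous_on UNIV (upper_obj P)"
    using assms(1)
    by (auto simp: bilevel_polynomial_problem_def intro: continuous_on_real_polynomial_function)
  have iter: "(x k, y k) \<in> alg_feasible P K q k"
    and min: "w \<in> alg_feasible P K q k \<Longrightarrow> upper_obj P (x k, y k) \<le> upper_obj P w" for k w
    using b unfolding infinite_run_def solves_P_def is_arg_min_linorder by blast+
  have ext: "polynomial_extension P K (x k) (y k) (z k) (q k)" for k
    using b unfolding infinite_run_def by blast
  have U: "(x k, y k) \<in> relaxed_feasible P" and S: "z k \<in> lower_solutions P (x k)"
    and qz: "q k (x k, y k) = z k" and qcont: "continuous_on UNIV (q k)"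
    and qZ: "\<And>x y. (x, y) \<in> relaxed_feasible P \<Longrightarrow> q k (x, y) \<in> lower_feasible P x" for k
    using ext[of k] unfolding polynomial_extension_def
    by (auto intro: continuous_on_polymonial_function)

  have "(xs, ys) \<in> relaxed_feasible P"
    using closed_sequentially[OF closed_relaxed_feasible[OF assms(1)] _ tendsto_Pair[OF x y]] U
    by blast
  moreover have "ys \<in> lower_solutions P xs"
  proof -
    have "(\<lambda>n. q (r n) (xs, ys)) \<longlonglongrightarrow> zs"
      using z by (intro tendsto_at_limit_point_if_equicontinuous[OF d tendsto_Pair[OF x y]])
        (simp add: qz)
    then have "(\<lambda>n. lower_obj P (xs, q (r n) (xs, ys))) \<longlonglongrightarrow> lower_obj P (xs, zs)"
      by (intro continuous_on_tendsto_compose[OF f] tendsto_Pair tendsto_const) auto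
    then have le: "lower_obj P (xs, ys) \<le> lower_obj P (xs, zs)"
      using cut_holds_at_accumulation_point[OF f qcont iter r x y] by (intro LIMSEQ_le_const) auto
    have "(\<lambda>n. value_function P (x (r n))) \<longlonglongrightarrow> value_function P xs"
      using c(2) x by (rule isCont_tendsto_compose)
    moreover have "(\<lambda>n. value_function P (x (r n))) \<longlonglongrightarrow> ereal (lower_obj P (xs, zs))"
      unfolding value_function_eq_lower_obj[OF S]
      by (intro tendsto_ereal continuous_on_tendsto_compose[OF f] tendsto_Pair x z) auto
    ultimately have v: "value_function P xs = ereal (lower_obj P (xs, zs))"
      by (rule LIMSEQ_unique)
    have "lower_obj P (xs, ys) \<le> lower_obj P (xs, z')" if "z' \<in> lower_feasible P xs" for z'
    proof -
      have "value_function P xs \<le> ereal (lower_obj P (xs, z'))"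
        unfolding value_function_def using that by (rule INF_lower)
      then show ?thesis
        using le v by simp
    qed
    moreover have "ys \<in> lower_feasible P xs"
      using \<open>(xs, ys) \<in> relaxed_feasible P\<close> by (simp add: relaxed_feasible_def)
    ultimately show ?thesis
      by (simp add: lower_solutions_iff)
  qed
  ultimately have feas: "(xs, ys) \<in> bilevel_feasible P"
    by (simp add: bilevel_feasible_iff)

  have K: "bilevel_feasible P \<subseteq> K"
    using bilevel_feasible_subset_KKT_set[OF assms(1-3)] assms(4) by simp
  have Flim: "(\<lambda>n. upper_obj P (x (r n), y (r n))) \<longlonglongrightarrow> upper_obj P (xs, ys)"
    by (intro continuous_on_tendsto_compose[OF F] tendsto_Pair x y) auto
  have "upper_obj P (xs, ys) \<le> upper_obj P w" if "w \<in> bilevel_feasible P" for w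
  proof (rule LIMSEQ_le_const2[OF Flim], intro exI allI impI)
    fix n
    have "w \<in> alg_feasible P K q (r n)"
      using bilevel_feasible_subset_alg_feasible[where q = q, OF K qZ] that by blast
    then show "upper_obj P (x (r n), y (r n)) \<le> upper_obj P w"
      by (rule min)
  qed
  with feas show ?thesis
    by (simp add: bilevel_minimizer_def is_arg_min_linorder)
qed

end
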